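(* Let $\beta<1$ be real, let $n\ge0$ be an integer and $\varepsilon=0$ for $n$ even, $\varepsilon=1$ for $n$ odd. Define \[ p_n(s;\beta)=\frac{\Gamma\left(\frac{n+s}{2}\right)}{\Gamma\left(\frac{s+\varepsilon}{2}\right)}\,{}_3F_2\left(1-\beta,\tfrac{1-n}{2},-\tfrac n2;2(1-\beta),1-\tfrac{n+s}{2};1\right). \] Then $p_n(s;\beta)$ is a polynomial in $s$ of degree $\lfloor n/2\rfloor$ with the perfect reflection property with $\chi=(-1)^{\lfloor n/2\rfloor}$; in particular $p_n(s;\beta)=(-1)^{\lfloor n/2\rfloor}p_n(1-s;\beta)$, its zeros lie only on the critical line $\Re s=1/2$, and all zeros $\ne1/2$ occur in complex conjugate pairs.
   Context: A function $f$ has the perfect reflection property (with sign $\chi\in\{1,-1\}$) if $f(\bar s)=\overline{f(s)}$, $f(s)=\chi f(1-s)$, and $f(s)=0$ only when $\Re s=1/2$. ${}_3F_2$ is the generalized hypergeometric function (terminating here). *)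

theory Defs
  imports "HOL-Complex_Analysis.Complex_Analysis"
begin

definition hypergeom_3F2 ::
    "complex \<Rightarrow> complex \<Rightarrow> complex \<Rightarrow> complex \<Rightarrow> complex \<Rightarrow> complex \<Rightarrow> complex" where
  "hypergeom_3F2 a b c d e z = eval_fps (fps_hypergeo [a, b, c] [d, e] 1) z"

definition perfect_reflection :: "complex \<Rightarrow> (complex \<Rightarrow> complex) \<Rightarrow> bool" where
  "perfect_reflection \<sigma> f \<longleftrightarrow>
     \<sigma> \<in> {1, -1} \<and>
     (\<forall>s. f (cnj s) = cnj (f s)) \<and>
     (\<forall>s. f s = \<sigma> * f (1 - s)) \<and>
     (\<forall>s. f s = 0 \<longrightarrow> Re s = 1 / 2)"

definition p_quot :: "nat \<Rightarrow> real \<Rightarrow> complex \<Rightarrow> complex" where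
  "p_quot n \<beta> s =
     (let \<epsilon> = (if even n then 0 else 1) in
      Gamma ((of_nat n + s) / 2) / Gamma ((s + \<epsilon>) / 2) *
      hypergeom_3F2 (1 - of_real \<beta>) ((1 - of_nat n) / 2) (- of_nat n / 2)
        (2 * (1 - of_real \<beta>)) (1 - (of_nat n + s) / 2) 1)"

(* The displayed formula is a meromorphic expression in s. It is undefined exactly where
   (s + \<epsilon>) / 2 is a non-positive integer: there the Gamma function in the denominator has a pole,
   and either the Gamma function in the numerator has one too or a denominator of the terminating
   hypergeometric sum vanishes. In HOL the expression takes conventional values at these isolated
   points (Gamma is 0 at its poles, x / 0 = 0). They are replaced by the limits;
   remove_sings does not change the value at a point where the formula is continuous. *)
definition p_fun :: "nat \<Rightarrow> real \<Rightarrow> complex \<Rightarrow> complex" where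
  "p_fun n \<beta> = remove_sings (p_quot n \<beta>)"

end

theory Submission
  imports Defs "HOL-Computational_Algebra.Fundamental_Theorem_Algebra"
begin

text \<open>
  Put \<open>m = n div 2\<close>, \<open>b = 1 - \<beta>\<close>, \<open>u = (s + \<epsilon>) / 2\<close> and \<open>\<kappa> = 1/2 + \<epsilon>\<close>. Up to a constant and the factor
  \<open>\<Gamma>(u + b + m) / \<Gamma>(u)\<close>, the function \<open>p_n\<close> is the Mellin transform in \<open>u\<close> of \<open>(1 - x)\<^sup>b\<^sup>-\<^sup>1 J(x)\<close>
  on \<open>(0, 1)\<close>, where \<open>J\<close> is the polynomial of degree \<open>m\<close> orthogonal to lower degrees for the weight
  \<open>x\<^sup>\<kappa>\<^sup>-\<^sup>1 (1 - x)\<^sup>2\<^sup>b\<^sup>-\<^sup>1\<close>. If \<open>u\<close> is a zero, then \<open>(1 - x)\<^sup>b\<^sup>-\<^sup>1 J\<close> is \<open>x h' + u h\<close> for some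
  \<open>h = (1 - x)\<^sup>b q\<close> with \<open>degree q < m\<close>. Orthogonality of \<open>J\<close> and \<open>q\<close> says that
  \<open>x h' + u h\<close> is orthogonal to \<open>h\<close> for the weight \<open>x\<^sup>\<kappa>\<^sup>-\<^sup>1\<close>; the real part of this relation and an integration by
  parts give \<open>(2 Re u - \<kappa>) \<integral> \<bar>h\<bar>\<^sup>2 x\<^sup>\<kappa>\<^sup>-\<^sup>1 = 0\<close>, so \<open>Re s = 1/2\<close>. The functional equation is a consequence:
  the polynomial is real and \<open>1 - s\<close> is conjugation on the critical line.
\<close>

section \<open>Beta integrals as a functional on polynomials\<close>

text \<open>The integral of \<open>f\<close> against \<open>x\<^sup>a\<^sup>-\<^sup>1 (1 - x)\<^sup>c\<^sup>-\<^sup>1\<close> on \<open>[0, 1]\<close>, normalised so that the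
  value is a polynomial in \<open>a\<close> if \<open>degree f \<le> M\<close>. Hence \<open>a\<close> may be any complex number.\<close>

definition beta_functional :: "nat \<Rightarrow> complex \<Rightarrow> complex \<Rightarrow> complex poly \<Rightarrow> complex" where
  "beta_functional M a c f =
     (\<Sum>j\<le>M. coeff f j * (pochhammer a j * pochhammer (a + c + of_nat j) (M - j)))"

lemma beta_functional_0 [simp]: "beta_functional M a c 0 = 0"
  and beta_functional_add: "beta_functional M a c (f + g) = beta_functional M a c f + beta_functional M a c g"
  and beta_functional_diff: "beta_functional M a c (f - g) = beta_functional M a c f - beta_functional M a c g"
  and beta_functional_smult: "beta_functional M a c (smult t f) = t * beta_functional M a c f"
  by (simp_all add: beta_functional_def sum.distrib sum_subtractf algebra_simps sum_distrib_left)

lemma beta_functional_sum: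
  "beta_functional M a c (sum f A) = (\<Sum>x\<in>A. beta_functional M a c (f x))"
  by (induction A rule: infinite_finite_induct) (simp_all add: beta_functional_add)

lemma coeff_X_power: "coeff ([:0, 1:] ^ i) n = (if i = n then 1 else 0 :: 'a :: comm_ring_1)"
proof -
  have "[:0, 1:] ^ i = (monom 1 i :: 'a poly)" by (simp add: monom_altdef)
  thus ?thesis by simp
qed

lemma beta_functional_X_power:
  assumes "i \<le> M"
  shows "beta_functional M a c ([:0, 1:] ^ i) = pochhammer a i * pochhammer (a + c + of_nat i) (M - i)"
proof -
  have "beta_functional M a c ([:0, 1:] ^ i) =
      (\<Sum>j\<le>M. if i = j then pochhammer a j * pochhammer (a + c + of_nat j) (M - j) else 0)"
    unfolding beta_functional_def by (intro sum.cong) (auto simp: coeff_X_power)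
  thus ?thesis using assms by simp
qed

text \<open>Up to the normalising factor (a + c)_M / B(a, c) this is Euler's Beta integral B(a + i,
  c + r). Splitting off one factor 1 - x raises i in one of the two terms, so the induction needs
  all i.\<close>

lemma beta_functional_bernstein:
  assumes "i + r \<le> M"
  shows "beta_functional M a c ([:0, 1:] ^ i * [:1, -1:] ^ r) =
           pochhammer c r * pochhammer a i * pochhammer (a + c + of_nat (i + r)) (M - (i + r))"
  using assms
proof (induction r arbitrary: i)
  case 0
  thus ?case by (simp add: beta_functional_X_power)
next
  case (Suc r)
  define z where "z = pochhammer (a + c + of_nat (i + Suc r)) (M - (i + Suc r))"
  have "M - (i + r) = Suc (M - (i + Suc r))"
    using Suc.prems by simp
  hence z: "pochhammer (a + c + of_nat (i + r)) (M - (i + r)) = (a + c + of_nat (i + r)) * z"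
    by (simp add: pochhammer_rec z_def add_ac)
  have "[:0, 1 :: complex:] ^ i * [:1, -1:] ^ Suc r =
        [:0, 1:] ^ i * [:1, -1:] ^ r - [:0, 1:] ^ Suc i * [:1, -1:] ^ r" (is "?lhs = ?rhs")
  proof -
    have aux: "A * (Y * B) = A * B - (X * A) * B" if "Y = 1 - X" for A B X Y :: "complex poly"
      unfolding that by (simp add: algebra_simps)
    show ?thesis unfolding power_Suc by (rule aux) (simp add: one_pCons)
  qed
  hence "beta_functional M a c ?lhs = beta_functional M a c ?rhs" by simp
  also have "\<dots> = pochhammer c r * pochhammer a i * ((a + c + of_nat (i + r)) * z) -
                  pochhammer c r * pochhammer a (Suc i) * z"
    unfolding beta_functional_diff using Suc.prems Suc.IH[of i] Suc.IH[of "Suc i"] z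
    by (simp add: z_def)
  also have "\<dots> = pochhammer c (Suc r) * pochhammer a i * z"
    by (simp add: pochhammer_Suc algebra_simps)
  finally show ?case by (simp add: z_def)
qed

section \<open>Integration by parts in algebraic form\<close>

text \<open>The derivative of \<open>x\<^sup>a (1 - x)\<^sup>c f\<close> divided by the weight \<open>x\<^sup>a\<^sup>-\<^sup>1 (1 - x)\<^sup>c\<^sup>-\<^sup>1\<close>.\<close>

definition beta_div :: "complex \<Rightarrow> complex \<Rightarrow> complex poly \<Rightarrow> complex poly" where
  "beta_div a c f = smult a ([:1, -1:] * f) - smult c ([:0, 1:] * f) + [:0, 1:] * [:1, -1:] * pderiv f"

lemma beta_div_0 [simp]: "beta_div a c 0 = 0"
  and beta_div_add: "beta_div a c (f + g) = beta_div a c f + beta_div a c g"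
  and beta_div_smult: "beta_div a c (smult t f) = smult t (beta_div a c f)"
  by (simp_all add: beta_div_def pderiv_add pderiv_smult algebra_simps smult_add_right smult_diff_right)

lemma beta_div_sum: "beta_div a c (sum g A) = (\<Sum>x\<in>A. beta_div a c (g x))"
  by (induction A rule: infinite_finite_induct) (simp_all add: beta_div_add)

lemma beta_div_X_power:
  "beta_div a c ([:0, 1:] ^ i) =
     smult (a + of_nat i) ([:0, 1:] ^ i) - smult (a + c + of_nat i) ([:0, 1:] ^ Suc i)"
proof -
  define X where "X = [:0, 1 :: complex:]"
  have Y: "[:1, -1:] = 1 - X" by (simp add: X_def one_pCons)
  have "pderiv X = 1" by (simp add: X_def pderiv_pCons)
  hence "X * pderiv (X ^ i) = smult (of_nat i) (X ^ i)"
    by (cases i) (simp_all only: pderiv_power_Suc, simp_all)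
  hence "X * (1 - X) * pderiv (X ^ i) = smult (of_nat i) (X ^ i - X ^ Suc i)"
    by (simp add: algebra_simps smult_diff_right)
  thus ?thesis
    unfolding beta_div_def Y X_def[symmetric]
    by (simp add: algebra_simps smult_diff_right smult_add_left)
qed

text \<open>The analytic reason is that the boundary terms of x^a (1 - x)^c f vanish. Checking
  monomials, where the two terms of \<open>beta_div_X_power\<close> cancel by the Pochhammer
  recursion, makes it valid for every complex a. Bounding coefficients instead of the degree admits
  f = 0 with M = 0.\<close>

lemma beta_functional_by_parts:
  assumes "\<And>j. j \<ge> M \<Longrightarrow> coeff f j = 0"
  shows "beta_functional M a c (beta_div a c f) = 0"
proof -
  have X_power: "beta_functional M a c (beta_div a c ([:0, 1:] ^ i)) = 0" if i: "i < M" for i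
  proof -
    have "pochhammer (a + c + of_nat i) (M - i) =
        (a + c + of_nat i) * pochhammer (a + c + of_nat (Suc i)) (M - Suc i)"
      using pochhammer_rec[of "a + c + of_nat i" "M - Suc i"] i by (simp add: Suc_diff_Suc add_ac)
    thus ?thesis using i
      by (simp add: beta_div_X_power beta_functional_diff beta_functional_smult beta_functional_X_power
            pochhammer_Suc del: power_Suc of_nat_Suc)
  qed
  have "f = (\<Sum>i<M. smult (coeff f i) ([:0, 1:] ^ i))"
  proof (rule poly_eqI)
    fix n
    have "coeff (\<Sum>i<M. smult (coeff f i) ([:0, 1:] ^ i)) n =
        (\<Sum>i<M. if i = n then coeff f i else 0)"
      unfolding coeff_sum by (intro sum.cong) (auto simp: coeff_X_power)
    thus "coeff f n = coeff (\<Sum>i<M. smult (coeff f i) ([:0, 1:] ^ i)) n"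
      using assms[of n] by auto
  qed
  hence "beta_div a c f = (\<Sum>i<M. smult (coeff f i) (beta_div a c ([:0, 1:] ^ i)))"
    by (metis (no_types, lifting) beta_div_smult beta_div_sum sum.cong)
  thus ?thesis
    by (simp add: beta_functional_sum beta_functional_smult X_power)
qed

text \<open>This is an m-th backward difference of a polynomial in z of degree i < m.\<close>

lemma alternating_binomial_sum_pochhammer:
  fixes z :: "'a :: field_char_0"
  assumes "i < m"
  shows "(\<Sum>k\<le>m. (-1) ^ k * of_nat (m choose k) * pochhammer (z - of_nat k) i) = 0"
proof -
  \<comment> \<open>Pascal's rule: a difference of order m + 1 is one of order m applied to the
    first difference of f.\<close>
  have rec: "(\<Sum>k\<le>Suc m. (-1) ^ k * of_nat (Suc m choose k) * f (z - of_nat k)) =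
        (\<Sum>k\<le>m. (-1) ^ k * of_nat (m choose k) * (f (z - of_nat k) - f (z - of_nat k - 1)))"
    for m and f :: "'a \<Rightarrow> 'a" and z
  proof -
    have A: "(\<Sum>k\<le>Suc m. (-1) ^ k * of_nat (Suc m choose k) * f (z - of_nat k)) =
      f z + (\<Sum>k\<le>m. (-1) ^ Suc k * of_nat ((m choose k) + (m choose Suc k)) * f (z - of_nat (Suc k)))"
      by (subst sum.atMost_Suc_shift) simp
    have B: "(\<Sum>k\<le>m. (-1) ^ k * of_nat (m choose k) * f (z - of_nat k)) =
      f z + (\<Sum>k\<le>m. (-1) ^ Suc k * of_nat (m choose Suc k) * f (z - of_nat (Suc k)))"
    proof -
      have "(\<Sum>k\<le>m. (-1) ^ k * of_nat (m choose k) * f (z - of_nat k)) =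
            (\<Sum>k\<le>Suc m. (-1) ^ k * of_nat (m choose k) * f (z - of_nat k))" by simp
      also have "\<dots> = f z + (\<Sum>k\<le>m. (-1) ^ Suc k * of_nat (m choose Suc k) * f (z - of_nat (Suc k)))"
        by (subst sum.atMost_Suc_shift) simp
      finally show ?thesis .
    qed
    have C: "f (z - of_nat k - 1) = f (z - of_nat (Suc k))" for k
      by (simp add: algebra_simps)
    show ?thesis
      unfolding right_diff_distrib sum_subtractf B A C
      by (simp add: algebra_simps sum.distrib sum_negf sum_subtractf)
  qed
  have diff: "pochhammer z (Suc i) - pochhammer (z - 1) (Suc i) = of_nat (Suc i) * pochhammer z i"
    for z :: 'a and i
    using pochhammer_rec[of "z - 1" i] by (simp add: pochhammer_Suc algebra_simps)
  show ?thesis using assms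
  proof (induction i arbitrary: m)
    case 0
    then obtain m' where "m = Suc m'" by (cases m) auto
    thus ?case using rec[of m' "\<lambda>_. 1" z] by simp
  next
    case (Suc i)
    then obtain m' where m: "m = Suc m'" "i < m'" by (cases m) auto
    have "(\<Sum>k\<le>m. (-1) ^ k * of_nat (m choose k) * pochhammer (z - of_nat k) (Suc i)) =
          (\<Sum>k\<le>m'. (-1) ^ k * of_nat (m' choose k) * (of_nat (Suc i) * pochhammer (z - of_nat k) i))"
      unfolding m(1) using rec[of m' "\<lambda>z. pochhammer z (Suc i)" z] unfolding diff .
    also have "\<dots> = of_nat (Suc i) *
        (\<Sum>k\<le>m'. (-1) ^ k * of_nat (m' choose k) * pochhammer (z - of_nat k) i)"
      by (simp only: sum_distrib_left mult_ac)
    also have "\<dots> = 0" using Suc.IH[OF m(2)] by simp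
    finally show ?case .
  qed
qed

section \<open>Genuine integrals and positivity\<close>

lemma Beta_add_of_nat_left:
  fixes a c :: real
  assumes "a > 0" "c > 0"
  shows "Beta (a + of_nat j) c = Beta a c * pochhammer a j / pochhammer (a + c) j"
proof (induction j)
  case (Suc j)
  have "a + real j \<notin> \<int>\<^sub>\<le>\<^sub>0" using assms by (auto elim!: nonpos_Ints_cases)
  hence "(a + j + c) * Beta (a + j + 1) c = (a + j) * Beta (a + j) c"
    by (rule Beta_plus1_left)
  moreover have "a + j + c > 0" using assms by linarith
  ultimately have "Beta (a + Suc j) c = (a + j) * Beta (a + j) c / (a + j + c)"
    by (simp add: field_simps)
  thus ?case by (simp add: Suc pochhammer_Suc add_ac)
qed simp_all

text \<open>The bridge from the algebraic functional to integrals, from which positivity is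
  drawn.\<close>

lemma has_integral_beta_functional:
  fixes a c :: real
  assumes ac: "a > 0" "c > 0" and f: "degree f \<le> M"
  shows "((\<lambda>x. poly f (of_real x) * of_real (x powr (a - 1) * (1 - x) powr (c - 1))) has_integral
            of_real (Beta a c / pochhammer (a + c) M) * beta_functional M (of_real a) (of_real c) f) {0..1}"
proof -
  have monom: "((\<lambda>x. of_real x ^ j * of_real (x powr (a - 1) * (1 - x) powr (c - 1))) has_integral
      complex_of_real (Beta (a + j) c)) {0..1}" for j :: nat
  proof -
    have "((\<lambda>x. x powr (a + j - 1) * (1 - x) powr (c - 1)) has_integral Beta (a + j) c) {0..1}"
      using ac by (intro has_integral_Beta_real) auto
    from has_integral_linear[OF this bounded_linear_of_real[where ?'a = complex]]
    show ?thesis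
    proof (rule has_integral_eq[rotated])
      fix x :: real assume x: "x \<in> {0..1}"
      have "x powr (a + j - 1) = x ^ j * x powr (a - 1)"
      proof (cases "x = 0")
        case False
        hence "x powr (real j + (a - 1)) = x ^ j * x powr (a - 1)"
          using x by (simp add: powr_add powr_realpow)
        thus ?thesis by (simp add: algebra_simps)
      qed auto
      thus "(complex_of_real \<circ> (\<lambda>x. x powr (a + j - 1) * (1 - x) powr (c - 1))) x =
            of_real x ^ j * of_real (x powr (a - 1) * (1 - x) powr (c - 1))" by simp
    qed
  qed
  have "((\<lambda>x. \<Sum>j\<le>M. coeff f j * (of_real x ^ j * of_real (x powr (a - 1) * (1 - x) powr (c - 1))))
      has_integral (\<Sum>j\<le>M. coeff f j * complex_of_real (Beta (a + j) c))) {0..1}"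
    by (intro has_integral_sum has_integral_mult_right monom) auto
  moreover have "(\<Sum>j\<le>M. coeff f j * complex_of_real (Beta (a + j) c)) =
      of_real (Beta a c / pochhammer (a + c) M) * beta_functional M (of_real a) (of_real c) f"
  proof -
    have "of_real (Beta a c / pochhammer (a + c) M) *
        (pochhammer (of_real a) j * pochhammer (of_real a + of_real c + of_nat j) (M - j)) =
        complex_of_real (Beta (a + j) c)" if "j \<le> M" for j
    proof -
      have "pochhammer (a + c) M \<noteq> 0" "pochhammer (a + c) j \<noteq> 0"
        using ac pochhammer_pos[of "a + c"] by (metis add_pos_pos less_irrefl)+
      hence "Beta (a + j) c = Beta a c / pochhammer (a + c) M *
        (pochhammer a j * pochhammer (a + c + j) (M - j))"
        using pochhammer_product[OF that, of "a + c"] ac by (simp add: Beta_add_of_nat_left field_simps)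
      thus ?thesis
        by (simp only: of_real_mult pochhammer_of_real[symmetric] of_real_add of_real_of_nat_eq)
    qed
    thus ?thesis
      unfolding beta_functional_def sum_distrib_left by (intro sum.cong) (simp_all add: mult_ac)
  qed
  moreover have "poly f z = (\<Sum>j\<le>M. coeff f j * z ^ j)" for z
    unfolding poly_altdef using f by (intro sum.mono_neutral_left) (auto simp: coeff_eq_0)
  ultimately show ?thesis by (simp only: sum_distrib_right mult.assoc)
qed

text \<open>On [0, 1] the integrand is (1 - x) |q|^2 times the weight, hence nonnegative; a
  vanishing integral would give q infinitely many zeros.\<close>

lemma beta_functional_pos:
  fixes a c :: real
  assumes ac: "a > 0" "c > 0" and q: "q \<noteq> 0" "2 * degree q + 1 \<le> M"
  obtains r where "r > 0"
    "beta_functional M (of_real a) (of_real c) ([:1, -1:] * (q * map_poly cnj q)) = of_real r"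
proof -
  define B where "B = Beta a c / pochhammer (a + c) M"
  have B: "B > 0"
    unfolding B_def Beta_def using ac
    by (intro divide_pos_pos mult_pos_pos pochhammer_pos Gamma_real_pos) auto
  define I where "I = beta_functional M (of_real a) (of_real c) ([:1, -1:] * (q * map_poly cnj q))"
  define g where "g = (\<lambda>x. (1 - x) * (cmod (poly q (of_real x)))\<^sup>2 * (x powr (a - 1) * (1 - x) powr (c - 1)))"
  have "degree (map_poly cnj q) = degree q" by (rule degree_map_poly) auto
  hence "degree ([:1, -1:] * (q * map_poly cnj q)) \<le> M"
    using q by (intro order.trans[OF degree_mult_le] order.trans[OF add_left_mono[OF degree_mult_le]]) auto
  note has_integral_beta_functional[OF ac this, folded B_def I_def]
  moreover have "poly ([:1, -1:] * (q * map_poly cnj q)) (of_real x) *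
      of_real (x powr (a - 1) * (1 - x) powr (c - 1)) = complex_of_real (g x)" for x
    unfolding g_def of_real_mult complex_norm_square by (simp add: algebra_simps)
  ultimately have "((\<lambda>x. complex_of_real (g x)) has_integral of_real B * I) {0..1}"
    by simp
  from has_integral_linear[OF this bounded_linear_Re] has_integral_linear[OF this bounded_linear_Im]
  have Re: "(g has_integral B * Re I) {0..1}" and Im: "((\<lambda>x. 0) has_integral B * Im I) {0..1}"
    by (simp_all add: o_def)
  have "Im I = 0" using has_integral_unique[OF Im has_integral_0] B by simp
  moreover have "Re I > 0"
  proof -
    have nonneg: "g x \<ge> 0" if "x \<in> {0..1}" for x using that by (auto simp: g_def)
    \<comment> \<open>The weight may be singular at 0 and 1, so continuity is used on an interior
      interval only.\<close>
    have cont: "continuous_on {1/4..3/4} g"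
      unfolding g_def by (intro continuous_intros) auto
    hence int: "g integrable_on {1/4..3/4}" by (rule integrable_continuous_real)
    have le: "integral {1/4..3/4} g \<le> B * Re I"
      using Re nonneg int by (intro has_integral_subset_le[OF _ integrable_integral[OF int] Re]) auto
    have "integral {1/4..3/4} g \<ge> 0"
      using nonneg int by (intro integral_nonneg) auto
    moreover have "integral {1/4..3/4} g \<noteq> 0"
    proof
      assume "integral {1/4..3/4} g = 0"
      hence 0: "(g has_integral 0) (cbox (1/4) (3/4))" using integrable_integral[OF int] by simp
      have "poly q (of_real x) = 0" if "x \<in> {1/4..3/4}" for x
      proof -
        have "g x = 0"
          using that cont nonneg by (intro has_integral_0_cbox_imp_0[OF _ _ 0]) auto
        thus ?thesis using that by (auto simp: g_def)
      qed
      hence "of_real ` {1/4..3/4::real} \<subseteq> {z. poly q z = 0}" by auto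
      moreover have "infinite (complex_of_real ` {1/4..3/4::real})"
        by (subst finite_image_iff) (auto simp: inj_on_def)
      ultimately show False using poly_roots_finite[OF q(1)] finite_subset by blast
    qed
    ultimately have "B * Re I > 0" using le by linarith
    thus ?thesis using B by (simp add: zero_less_mult_iff)
  qed
  ultimately show ?thesis using that[of "Re I"] by (simp add: I_def complex_eq_iff)
qed

lemma map_poly_cnj_eqI: "(\<And>z. cnj (poly f (cnj z)) = poly g z) \<Longrightarrow> map_poly cnj f = g"
  by (simp flip: poly_eq_poly_eq_iff add: fun_eq_iff)

section \<open>Reduction modulo weighted derivatives\<close>

text \<open>Modulo the image of \<open>beta_div\<close>, (a + i) x^i is congruent to (a + c + i)
  x^(i+1). Division by a + i thus pushes all lower powers up to x^m.\<close>

lemma beta_div_decompose: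
  assumes "\<And>i. a + of_nat i \<noteq> 0" "degree f \<le> m"
  obtains q t where "f = beta_div a c q + smult t ([:0, 1:] ^ m)" "q = 0 \<or> degree q < m"
proof -
  have "\<exists>q t. f = beta_div a c q + smult t ([:0, 1:] ^ m) \<and> (q = 0 \<or> degree q < m)"
    using assms(2)
  proof (induction m arbitrary: f)
    case 0
    then obtain t where "f = [:t:]" by (auto elim: degree_eq_zeroE)
    thus ?case by (intro exI[of _ 0] exI[of _ t]) (simp add: one_pCons)
  next
    case (Suc m)
    define X where "X = [:0, 1 :: complex:]"
    define t1 where "t1 = coeff f (Suc m)"
    have "degree (f - smult t1 (X ^ Suc m)) \<le> m"
      using Suc.prems
      by (intro degree_le) (auto simp: coeff_X_power X_def t1_def coeff_eq_0 simp del: power_Suc)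
    from Suc.IH[OF this] obtain q t where
      qt: "f - smult t1 (X ^ Suc m) = beta_div a c q + smult t (X ^ m)" "q = 0 \<or> degree q < m"
      unfolding X_def by blast
    \<comment> \<open>Chosen so that \<open>beta_div\<close> of e x^m has the term t x^m and
      otherwise only a multiple of x^(m+1).\<close>
    define e where "e = t / (a + of_nat m)"
    define p where "p = q + smult e (X ^ m)"
    have "smult t (X ^ m) = beta_div a c (smult e (X ^ m)) + smult (e * (a + c + of_nat m)) (X ^ Suc m)"
      using assms(1)[of m]
      by (simp add: beta_div_smult X_def beta_div_X_power smult_diff_right e_def del: power_Suc)
    hence "f = beta_div a c p + smult (t1 + e * (a + c + of_nat m)) (X ^ Suc m)"
      using qt(1) by (simp add: p_def beta_div_add smult_add_left algebra_simps del: power_Suc)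
    moreover have "degree p < Suc m"
    proof -
      have "degree q \<le> m" using qt(2) by auto
      moreover have "degree (smult e (X ^ m)) \<le> m"
        by (intro order.trans[OF degree_smult_le] degree_le) (auto simp: X_def coeff_X_power)
      ultimately show ?thesis by (simp add: p_def degree_add_le less_Suc_eq_le)
    qed
    ultimately show ?case by (auto simp: X_def)
  qed
  thus ?thesis using that by blast
qed

section \<open>Jacobi polynomials and their orthogonality\<close>

text \<open>The coefficients, in the basis \<open>x\<^sup>m\<^sup>-\<^sup>k (1 - x)\<^sup>k\<close>, of the Jacobi polynomial of degree \<open>m\<close>
  on the unit interval for the weight \<open>x\<^sup>a\<^sup>-\<^sup>1 (1 - x)\<^sup>c\<^sup>-\<^sup>1\<close>.\<close>

definition jacobi_coeff :: "nat \<Rightarrow> real \<Rightarrow> real \<Rightarrow> nat \<Rightarrow> real" where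
  "jacobi_coeff m a c k =
     (-1) ^ k * real (m choose k) * pochhammer a m / (pochhammer c k * pochhammer a (m - k))"

definition jacobi_poly01 :: "nat \<Rightarrow> real \<Rightarrow> real \<Rightarrow> complex poly" where
  "jacobi_poly01 m a c =
     (\<Sum>k\<le>m. smult (of_real (jacobi_coeff m a c k)) ([:0, 1:] ^ (m - k) * [:1, -1:] ^ k))"

lemma degree_jacobi_poly01: "degree (jacobi_poly01 m a c) \<le> m"
proof -
  have "degree ([:0, 1:] ^ (m - k) * [:1, -1:] ^ k :: complex poly) \<le> m" if "k \<le> m" for k
    using that by (intro order.trans[OF degree_mult_le] order.trans[OF add_mono[OF degree_power_le degree_power_le]]) auto
  thus ?thesis
    unfolding jacobi_poly01_def
    by (intro degree_sum_le) (auto intro: order.trans[OF degree_smult_le])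
qed

text \<open>In the Beta values (c)_k cancels, and (a)_(m-k+i) / (a)_(m-k) = (a + m - k)_i is a
  polynomial in k of degree i < m, so the alternating binomial sum vanishes.\<close>

lemma jacobi_poly01_orthogonal_X_power:
  fixes a c :: real
  assumes ac: "a > 0" "c > 0" and i: "i < m" "m + i \<le> M"
  shows "beta_functional M (of_real a) (of_real c) (jacobi_poly01 m a c * [:0, 1:] ^ i) = 0"
proof -
  \<comment> \<open>All products x^(m-k+i) (1 - x)^k have total degree m + i, so this factor does
    not depend on k.\<close>
  define z where "z = pochhammer (of_real a + of_real c + of_nat (m + i)) (M - (m + i)) * (of_real (pochhammer a m) :: complex)"
  have summand: "of_real (jacobi_coeff m a c k) *
        beta_functional M (of_real a) (of_real c) ([:0, 1:] ^ (m - k + i) * [:1, -1:] ^ k) =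
        z * ((-1) ^ k * of_nat (m choose k) * pochhammer (of_real (a + m) - of_nat k) i)"
    if "k \<le> m" for k
  proof -
    have "pochhammer c k \<noteq> 0" "pochhammer a (m - k) \<noteq> 0"
      using ac pochhammer_pos less_irrefl by metis+
    hence "jacobi_coeff m a c k * (pochhammer c k * pochhammer a (m - k + i)) =
        pochhammer a m * ((-1) ^ k * real (m choose k) * pochhammer (a + real (m - k)) i)"
      by (simp add: jacobi_coeff_def pochhammer_product')
    from arg_cong[OF this, of complex_of_real]
    have "complex_of_real (jacobi_coeff m a c k) *
          (pochhammer (of_real c) k * pochhammer (of_real a) (m - k + i)) =
        of_real (pochhammer a m) *
          ((-1) ^ k * of_nat (m choose k) * pochhammer (of_real a + of_nat (m - k)) i)"
      by (simp only: of_real_mult pochhammer_of_real[symmetric] of_real_add of_real_of_nat_eq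
            of_real_power of_real_minus of_real_1)
    also have "of_real a + of_nat (m - k) = complex_of_real (a + m) - of_nat k"
      using that by (simp add: of_nat_diff)
    finally have "complex_of_real (jacobi_coeff m a c k) *
          (pochhammer (of_real c) k * pochhammer (of_real a) (m - k + i)) =
        of_real (pochhammer a m) *
          ((-1) ^ k * of_nat (m choose k) * pochhammer (of_real (a + m) - of_nat k) i)" .
    moreover have "m - k + i + k = m + i" using that by simp
    ultimately show ?thesis
      using i(2) by (subst beta_functional_bernstein) (simp_all add: z_def mult_ac)
  qed
  have "beta_functional M (of_real a) (of_real c) (jacobi_poly01 m a c * [:0, 1:] ^ i) =
     (\<Sum>k\<le>m. of_real (jacobi_coeff m a c k) *
        beta_functional M (of_real a) (of_real c) ([:0, 1:] ^ (m - k + i) * [:1, -1:] ^ k))"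
    unfolding jacobi_poly01_def sum_distrib_right mult_smult_left beta_functional_sum
      beta_functional_smult by (simp only: power_add mult_ac)
  also have "\<dots> = z * (\<Sum>k\<le>m. (-1) ^ k * of_nat (m choose k) * pochhammer (of_real (a + m) - of_nat k) i)"
    unfolding sum_distrib_left by (intro sum.cong refl summand) simp
  also have "\<dots> = 0" by (simp only: alternating_binomial_sum_pochhammer[OF i(1)] mult_zero_right)
  finally show ?thesis .
qed

lemma poly_as_sum_X_power: "degree f \<le> m \<Longrightarrow> f = (\<Sum>i\<le>m. smult (coeff f i) ([:0, 1 :: complex:] ^ i))"
  by (simp add: poly_as_sum_of_monoms' flip: monom_altdef)

lemma jacobi_poly01_orthogonal:
  fixes a c :: real
  assumes ac: "a > 0" "c > 0" and g: "degree g < m" "m + degree g \<le> M"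
  shows "beta_functional M (of_real a) (of_real c) (jacobi_poly01 m a c * g) = 0"
proof -
  have "beta_functional M (of_real a) (of_real c) (jacobi_poly01 m a c * g) =
     (\<Sum>i\<le>degree g. coeff g i *
        beta_functional M (of_real a) (of_real c) (jacobi_poly01 m a c * [:0, 1:] ^ i))"
    using arg_cong[OF poly_as_sum_X_power[OF order.refl], of "\<lambda>f. jacobi_poly01 m a c * f" g]
    by (simp add: sum_distrib_left beta_functional_sum beta_functional_smult)
  also have "\<dots> = 0"
    using g by (intro sum.neutral) (auto intro!: jacobi_poly01_orthogonal_X_power[OF ac])
  finally show ?thesis .
qed

section \<open>The transform of the Jacobi polynomial and its zeros\<close>

lemma beta_functional_cnj:
  "beta_functional M (of_real a) (of_real c) (map_poly cnj f) = cnj (beta_functional M (of_real a) (of_real c) f)"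
  by (simp add: beta_functional_def coeff_map_poly cnj_sum pochhammer_prod)

text \<open>With M = m the third factor in \<open>beta_functional_bernstein\<close> is an empty
  product. For a = 1/2 + \<epsilon>, c = 2 b and c' = b = 1 - \<beta> the right-hand side is p_n as
  a polynomial in u.\<close>

lemma beta_functional_jacobi_poly01:
  "beta_functional m u c' (jacobi_poly01 m a c) =
     (\<Sum>k\<le>m. of_real (jacobi_coeff m a c k) * pochhammer c' k * pochhammer u (m - k))"
  by (simp add: jacobi_poly01_def beta_functional_sum beta_functional_smult beta_functional_bernstein mult.assoc)

text \<open>At a nonpositive integer all summands of the transform have the same sign.\<close>

lemma jacobi_transform_nonpos_int:
  fixes a c b :: real
  assumes "a > 0" "c > 0" "b > 0"
  shows "(\<Sum>k\<le>m. of_real (jacobi_coeff m a c k) * pochhammer (of_real b) k *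
            pochhammer (- of_nat j) (m - k)) \<noteq> (0 :: complex)"
proof -
  define t where "t = (\<lambda>k. real (m choose k) * pochhammer a m / (pochhammer c k * pochhammer a (m - k)) *
      pochhammer b k * (\<Prod>i<m - k. if i < j then real (j - i) else 0))"
  have poch: "pochhammer (- real j) k = (-1) ^ k * (\<Prod>i<k. if i < j then real (j - i) else 0)" for k
  proof (induction k)
    case (Suc k)
    show ?case
    proof (cases "k \<le> j")
      case True thus ?thesis by (simp add: Suc pochhammer_Suc of_nat_diff algebra_simps)
    next
      case False
      hence "pochhammer (- real j) k = 0" by (simp add: pochhammer_of_nat_eq_0_iff)
      thus ?thesis using Suc by (auto simp: pochhammer_Suc)
    qed
  qed auto
  have "jacobi_coeff m a c k * pochhammer b k * pochhammer (- real j) (m - k) = (-1) ^ m * t k"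
    if "k \<le> m" for k
  proof -
    have "(-1) ^ m = (-1 :: real) ^ k * (-1) ^ (m - k)" using that by (simp flip: power_add)
    thus ?thesis by (simp add: jacobi_coeff_def t_def poch mult_ac)
  qed
  hence "(\<Sum>k\<le>m. jacobi_coeff m a c k * pochhammer b k * pochhammer (- real j) (m - k)) =
      (-1) ^ m * (\<Sum>k\<le>m. t k)"
    unfolding sum_distrib_left by (intro sum.cong) auto
  moreover have "(\<Sum>k\<le>m. t k) > 0"
  proof (rule sum_pos2[of _ m])
    show "t m > 0" using assms by (simp add: t_def pochhammer_pos)
    show "t k \<ge> 0" for k
      unfolding t_def using assms
      by (intro mult_nonneg_nonneg divide_nonneg_nonneg prod_nonneg) (auto simp: pochhammer_nonneg)
  qed auto
  ultimately have "complex_of_real (\<Sum>k\<le>m. jacobi_coeff m a c k * pochhammer b k * pochhammer (- real j) (m - k)) \<noteq> 0"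
    by (simp del: of_real_sum)
  thus ?thesis by (simp flip: pochhammer_of_real)
qed

lemma jacobi_transform_zeros:
  fixes a b :: real
  assumes ab: "a > 0" "b > 0"
    and zero: "(\<Sum>k\<le>m. of_real (jacobi_coeff m a (2 * b) k) * pochhammer (of_real b) k *
            pochhammer u (m - k)) = 0"
  shows "Re u = a / 2"
proof -
  define J where "J = jacobi_poly01 m a (2 * b)"
  define M where "M = 2 * m + 1"
  define L where "L = beta_functional M (of_real a) (of_real (2 * b))"
  \<comment> \<open>A zero u is not a nonpositive integer, which is what the decomposition
    requires.\<close>
  have u: "u + of_nat i \<noteq> 0" for i
    using jacobi_transform_nonpos_int[of a "2 * b" b m i] ab zero by (auto simp: add_eq_0_iff2)
  obtain q t where qt: "J = beta_div u (of_real b) q + smult t ([:0, 1:] ^ m)" "q = 0 \<or> degree q < m"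
    using beta_div_decompose[OF u degree_jacobi_poly01] unfolding J_def by metis
  have "beta_functional m u (of_real b) J = 0"
    using zero by (simp add: J_def beta_functional_jacobi_poly01)
  moreover have "beta_functional m u (of_real b) (beta_div u (of_real b) q) = 0"
    using qt(2) by (intro beta_functional_by_parts) (auto simp: coeff_eq_0)
  \<comment> \<open>Integration by parts removes q, so the vanishing transform equals t
    (u)_m.\<close>
  ultimately have "t * pochhammer u m = 0"
    by (simp add: qt(1) beta_functional_add beta_functional_smult beta_functional_X_power)
  moreover have "pochhammer u m \<noteq> 0"
    using u by (auto simp: pochhammer_eq_0_iff add_eq_0_iff2)
  ultimately have J: "J = beta_div u (of_real b) q" using qt(1) by simp
  \<comment> \<open>The transform of J at 0 is nonzero, hence so is J.\<close>
  have "q \<noteq> 0"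
  proof
    assume "q = 0"
    hence "J = 0" by (simp add: J)
    thus False
      using jacobi_transform_nonpos_int[of a "2 * b" b m 0] ab
      by (simp add: J_def flip: beta_functional_jacobi_poly01)
  qed
  hence q: "degree q < m" using qt(2) by simp
  define q' where "q' = map_poly cnj q"
  have deg_q': "degree q' = degree q" unfolding q'_def by (rule degree_map_poly) auto
  \<comment> \<open>On the real axis \<open>q'\<close> and A are the conjugates of q and J q', so J
    q' + A is twice a real part.\<close>
  define A where "A = map_poly cnj (J * q')"
  have A: "A = beta_div (cnj u) (of_real b) q' * q"
  proof -
    have "pderiv q' = map_poly cnj (pderiv q)"
      by (rule poly_eqI) (simp add: q'_def coeff_pderiv coeff_map_poly)
    hence "poly (pderiv q') z = cnj (poly (pderiv q) (cnj z))" for z by simp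
    thus ?thesis
      unfolding A_def by (intro map_poly_cnj_eqI) (simp add: J beta_div_def q'_def)
  qed
  \<comment> \<open>Product rule for q q': the two exponents b add up to the 2 b of the
    orthogonality weight, so only terms with the factor (1 - x) q q' survive.\<close>
  have "J * q' + A - beta_div (of_real a) (of_real (2 * b)) (q * q') =
          smult (of_real (2 * Re u - a)) ([:1, -1:] * (q * q'))"
  proof -
    have Re: "complex_of_real (Re u) = (u + cnj u) / 2" by (simp add: complex_add_cnj)
    show ?thesis
      unfolding A J beta_div_def
      by (simp flip: poly_eq_poly_eq_iff add: fun_eq_iff pderiv_mult Re field_simps)
  qed
  moreover have "L (J * q') = 0"
    unfolding L_def J_def using ab q by (intro jacobi_poly01_orthogonal) (auto simp: deg_q' M_def)
  moreover have "L A = 0"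
    using \<open>L (J * q') = 0\<close> unfolding L_def A_def beta_functional_cnj by simp
  moreover have "L (beta_div (of_real a) (of_real (2 * b)) (q * q')) = 0"
    unfolding L_def
  proof (intro beta_functional_by_parts coeff_eq_0)
    show "degree (q * q') < j" if "M \<le> j" for j
      using degree_mult_le[of q q'] q that by (simp add: deg_q' M_def)
  qed
  ultimately have "of_real (2 * Re u - a) * L ([:1, -1:] * (q * q')) = 0"
    unfolding L_def by (metis beta_functional_add beta_functional_diff beta_functional_smult add_0 diff_0_right)
  moreover obtain r where "r > 0" "L ([:1, -1:] * (q * q')) = of_real r"
    using beta_functional_pos[of a "2 * b" q M] ab q \<open>q \<noteq> 0\<close> unfolding L_def q'_def M_def by auto
  ultimately have "2 * Re u - a = 0" by (metis less_irrefl mult_eq_0_iff of_real_eq_0_iff)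
  thus ?thesis by simp
qed

section \<open>Polynomials: Pochhammer products, conjugation, reflection\<close>

lemma poly_pochhammer: "poly (pochhammer p k) x = pochhammer (poly p x) k"
  by (induction k) (simp_all add: pochhammer_Suc)

lemma degree_pochhammer_linear:
  fixes a b :: "'a :: field_char_0"
  assumes "b \<noteq> 0"
  shows "degree (pochhammer [:a, b:] k) = k"
proof (induction k)
  case (Suc k)
  have lin: "[:a, b:] + of_nat k = [:a + of_nat k, b:]" by (simp add: of_nat_poly)
  have "pochhammer [:a, b:] k \<noteq> 0"
    using Suc by (cases k) auto
  hence "degree (pochhammer [:a, b:] k * [:a + of_nat k, b:]) = Suc k"
    using Suc assms by (subst degree_mult_eq) auto
  thus ?case by (simp only: pochhammer_Suc lin)
qed simp

text \<open>Conjugating the factor (x - z)^\<open>order z p\<close> gives a factor at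
  \<open>cnj z\<close>. Applied at both z and \<open>cnj z\<close>, it yields equal
  multiplicities.\<close>

lemma order_cnj_le:
  assumes "map_poly cnj p = p" "p \<noteq> 0"
  shows "order z p \<le> order (cnj z) p"
proof -
  obtain q where q: "p = [:-z, 1:] ^ order z p * q"
    using order_1[of z p] by (metis dvdE)
  have "p = map_poly cnj ([:-z, 1:] ^ order z p * q)"
    using assms(1) q by simp
  also have "\<dots> = [:-cnj z, 1:] ^ order z p * map_poly cnj q"
    by (rule map_poly_cnj_eqI) simp
  finally have "[:-cnj z, 1:] ^ order z p dvd p" by (rule dvdI)
  thus ?thesis using assms(2) by (simp add: order_divides)
qed

text \<open>A root r on the line satisfies cnj r = 1 - r, so s - cnj r = -((1 - s) - r). Conjugating
  the linear factorisation therefore produces one sign per root.\<close>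

lemma zeros_on_critical_line_reflection:
  fixes p :: "complex poly"
  assumes real: "map_poly cnj p = p" and zeros: "\<And>s. poly p s = 0 \<Longrightarrow> Re s = 1 / 2"
  shows "poly p s = (-1) ^ degree p * poly p (1 - s)"
proof (cases "p = 0")
  case False
  have p: "poly p z = lead_coeff p * (\<Prod>r\<in>#proots p. z - r)" for z
    by (subst (1) complex_poly_decompose_multiset[symmetric])
       (simp add: poly_prod_mset)
  have cnj_prod: "cnj (\<Prod>r\<in>#A. f r) = (\<Prod>r\<in>#A. cnj (f r))" for A and f :: "complex \<Rightarrow> complex"
    by (induction A) auto
  have cnj_lead: "cnj (lead_coeff p) = lead_coeff p"
    by (metis coeff_map_poly complex_cnj_zero real)
  have "poly p s = cnj (poly p (cnj s))"
    using real by (metis poly_map_poly_cnj)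
  also have "\<dots> = lead_coeff p * (\<Prod>r\<in>#proots p. s - cnj r)"
    unfolding p by (simp add: cnj_lead cnj_prod)
  also have "(\<Prod>r\<in>#proots p. s - cnj r) = (\<Prod>r\<in>#proots p. (-1) * ((1 - s) - r))"
  proof (intro arg_cong[of _ _ prod_mset] image_mset_cong)
    fix r assume "r \<in># proots p"
    hence "Re r = 1 / 2" using zeros False by simp
    thus "s - cnj r = (-1) * ((1 - s) - r)" by (simp add: complex_eq_iff)
  qed
  also have "\<dots> = (-1) ^ degree p * (\<Prod>r\<in>#proots p. (1 - s) - r)"
    by (simp only: prod_mset.distrib prod_mset_constant size_proots_complex)
  finally show ?thesis unfolding p[of "1 - s"] by (simp add: mult_ac)
qed simp

section \<open>The polynomial behind p_n\<close>

text \<open>The transform in \<open>beta_functional_jacobi_poly01\<close> at u = (s + \<epsilon>) /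
  2, written as a polynomial in s; \<open>n mod 2\<close> is \<epsilon>.\<close>

definition p_poly :: "nat \<Rightarrow> real \<Rightarrow> complex poly" where
  "p_poly n \<beta> = (\<Sum>k\<le>n div 2.
     smult (of_real (jacobi_coeff (n div 2) (1 / 2 + real (n mod 2)) (2 * (1 - \<beta>)) k * pochhammer (1 - \<beta>) k))
       (pochhammer [:of_nat (n mod 2) / 2, 1 / 2:] (n div 2 - k)))"

lemma poly_p_poly: "poly (p_poly n \<beta>) s =
    (\<Sum>k\<le>n div 2. of_real (jacobi_coeff (n div 2) (1 / 2 + real (n mod 2)) (2 * (1 - \<beta>)) k) *
       pochhammer (of_real (1 - \<beta>)) k * pochhammer ((s + of_nat (n mod 2)) / 2) (n div 2 - k))"
  by (simp add: p_poly_def poly_sum poly_pochhammer add_divide_distrib add.commute pochhammer_of_real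
        del: of_real_diff)

lemma map_poly_cnj_p_poly: "map_poly cnj (p_poly n \<beta>) = p_poly n \<beta>"
  by (rule map_poly_cnj_eqI) (simp add: poly_p_poly pochhammer_prod)

lemma degree_p_poly: "degree (p_poly n \<beta>) = n div 2"
proof -
  define m where "m = n div 2"
  define a :: real where "a = 1 / 2 + real (n mod 2)"
  define X where "X = (\<lambda>k. pochhammer [:of_nat (n mod 2) / 2, 1 / 2 :: complex:] k)"
  define c where "c = (\<lambda>k. complex_of_real (jacobi_coeff m a (2 * (1 - \<beta>)) k * pochhammer (1 - \<beta>) k))"
  have p: "p_poly n \<beta> = (\<Sum>k\<le>m. smult (c k) (X (m - k)))"
    by (simp add: p_poly_def m_def a_def X_def c_def)
  have X: "degree (X k) = k" for k by (simp add: X_def degree_pochhammer_linear)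
  have le: "degree (p_poly n \<beta>) \<le> m"
    unfolding p by (intro degree_sum_le) (auto intro: order.trans[OF degree_smult_le] simp: X)
  \<comment> \<open>Only k = 0 reaches degree m, and its scalar is (a)_m / (a)_m = 1.\<close>
  have "coeff (p_poly n \<beta>) m = (\<Sum>k\<le>m. if k = 0 then coeff (X m) m else 0)"
    unfolding p coeff_sum coeff_smult
  proof (intro sum.cong refl)
    fix k assume "k \<in> {..m}"
    moreover have "pochhammer a m \<noteq> 0"
      using pochhammer_pos[of a m] by (simp add: a_def)
    ultimately show "c k * coeff (X (m - k)) m = (if k = 0 then coeff (X m) m else 0)"
      by (auto simp: c_def jacobi_coeff_def X coeff_eq_0)
  qed
  moreover have "coeff (X m) m \<noteq> 0"
    using X[of m] by (cases m) (auto simp: X_def, metis degree_0 leading_coeff_0_iff nat.distinct(1))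
  ultimately have "coeff (p_poly n \<beta>) m \<noteq> 0" by simp
  thus ?thesis using le le_degree[of "p_poly n \<beta>" m] by (simp add: m_def)
qed

lemma p_poly_zeros:
  assumes "\<beta> < 1" "poly (p_poly n \<beta>) s = 0"
  shows "Re s = 1 / 2"
proof -
  have "Re ((s + of_nat (n mod 2)) / 2) = (1 / 2 + real (n mod 2)) / 2"
    using assms unfolding poly_p_poly by (intro jacobi_transform_zeros[of _ "1 - \<beta>"]) auto
  thus ?thesis by simp
qed

section \<open>Identification with the hypergeometric formula\<close>

text \<open>Up to sign, (1 - x - m)_k consists of the last k factors of (x)_m in reverse. This turns
  the series parameters 1 - a - m and 1 - u - m into rising factorials of a and u.\<close>

lemma pochhammer_split_reflect:
  assumes "k \<le> m"
  shows "pochhammer x m = (-1) ^ k * pochhammer (1 - x - of_nat m) k * pochhammer (x :: 'a :: comm_ring_1) (m - k)"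
proof -
  have "pochhammer (- (x + of_nat m - 1)) k = (-1) ^ k * pochhammer (x + of_nat m - of_nat k) k"
    by (subst pochhammer_minus) (simp add: algebra_simps)
  hence "pochhammer (1 - x - of_nat m) k = (-1) ^ k * pochhammer (x + of_nat m - of_nat k) k"
    by (simp add: algebra_simps)
  hence "(-1) ^ k * pochhammer (1 - x - of_nat m) k * pochhammer x (m - k) =
      ((-1) ^ k * (-1) ^ k) * (pochhammer x (m - k) * pochhammer (x + of_nat m - of_nat k) k)"
    by (simp only: mult_ac)
  also have "(-1) ^ k * (-1) ^ k = (1 :: 'a)" by (simp flip: power_mult_distrib)
  also have "pochhammer x (m - k) * pochhammer (x + of_nat m - of_nat k) k = pochhammer x m"
    using pochhammer_product[of "m - k" m x] assms by (simp add: of_nat_diff algebra_simps)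
  finally show ?thesis by simp
qed

text \<open>Away from the poles the Gamma quotient is (u)_m with u = (s + \<epsilon>) / 2, which
  clears the s-dependent denominators of the terminating series.\<close>

lemma p_quot_eq:
  assumes \<beta>: "\<beta> < 1" and u: "(s + of_nat (n mod 2)) / 2 \<notin> \<int>\<^sub>\<le>\<^sub>0"
  shows "p_quot n \<beta> s = poly (p_poly n \<beta>) s"
proof -
  define m e where "m = n div 2" and "e = n mod 2"
  define a b :: real where "a = 1 / 2 + e" and "b = 1 - \<beta>"
  define u where "u = (s + of_nat e) / 2"
  have "n = 2 * m + e" by (simp add: m_def e_def)
  hence n: "complex_of_nat n = 2 * of_nat m + of_nat e" by simp
  have ns: "(of_nat n + s) / 2 = u + of_nat m"
    by (simp add: n u_def field_simps)
  \<comment> \<open>The parameters (1 - n) / 2 and -n / 2 are -m and 1 - a - m, in an order that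
    depends on the parity of n.\<close>
  have params: "pochhammer ((1 - of_nat n) / 2) k * pochhammer (- of_nat n / 2) k =
      (pochhammer (- of_nat m) k * pochhammer (1 - of_real a - of_nat m) k :: complex)" for k
  proof -
    consider "e = 0" | "e = 1" unfolding e_def by linarith
    thus ?thesis
    proof cases
      assume e: "e = 0"
      have "(1 - of_nat n) / 2 = 1 - of_real a - (of_nat m :: complex)"
           "- of_nat n / 2 = - (of_nat m :: complex)"
        unfolding n a_def e by (simp_all add: field_simps)
      thus ?thesis by (simp only: mult.commute)
    next
      assume e: "e = 1"
      have "(1 - of_nat n) / 2 = - (of_nat m :: complex)"
           "- of_nat n / 2 = 1 - of_real a - (of_nat m :: complex)"
        unfolding n a_def e by (simp_all add: field_simps)
      thus ?thesis by (simp only: mult.commute)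
    qed
  qed
  define c where "c = (\<lambda>k. pochhammer (of_real b) k * (pochhammer (- of_nat m) k * pochhammer (1 - of_real a - of_nat m) k) /
      (pochhammer (of_real (2 * b)) k * pochhammer (1 - u - of_nat m) k * fact k :: complex))"
  have "hypergeom_3F2 (1 - of_real \<beta>) ((1 - of_nat n) / 2) (- of_nat n / 2)
        (2 * (1 - of_real \<beta>)) (1 - (of_nat n + s) / 2) 1 = (\<Sum>k. c k)"
    unfolding hypergeom_3F2_def eval_fps_def c_def params[symmetric]
    by (simp add: b_def ns mult.assoc diff_diff_eq)
  \<comment> \<open>(-m)_k is 0 for k > m, so these terms are 0 even where a denominator
    vanishes.\<close>
  also have "\<dots> = (\<Sum>k\<le>m. c k)"
    by (intro suminf_finite) (auto simp: c_def pochhammer_of_nat_eq_0_iff)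
  finally have hyp: "hypergeom_3F2 (1 - of_real \<beta>) ((1 - of_nat n) / 2) (- of_nat n / 2)
        (2 * (1 - of_real \<beta>)) (1 - (of_nat n + s) / 2) 1 = (\<Sum>k\<le>m. c k)" .
  have "pochhammer u m * (\<Sum>k\<le>m. c k) = poly (p_poly n \<beta>) s"
    unfolding poly_p_poly m_def[symmetric] e_def[symmetric] a_def[symmetric] b_def[symmetric]
      u_def[symmetric] sum_distrib_left
  proof (intro sum.cong refl)
    fix k assume "k \<in> {..m}"
    hence k: "k \<le> m" by simp
    have um: "pochhammer u m \<noteq> 0"
      using assms(2) by (auto simp: pochhammer_eq_0_iff u_def e_def)
    have "pochhammer a m \<noteq> 0" "pochhammer a (m - k) \<noteq> 0"
      using pochhammer_pos[of a] by (auto simp: a_def less_le)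
    hence am: "pochhammer (complex_of_real a) m \<noteq> 0" "pochhammer (complex_of_real a) (m - k) \<noteq> 0"
      by (simp_all only: pochhammer_of_real of_real_eq_0_iff not_False_eq_True)
    have 1: "pochhammer (- of_nat m) k = fact k * ((-1) ^ k * of_nat (m choose k) :: complex)"
      using k by (simp add: binomial_gbinomial gbinomial_pochhammer)
    have 2: "pochhammer u m / pochhammer (1 - u - of_nat m) k = (-1) ^ k * pochhammer u (m - k)"
    proof -
      have "pochhammer u m = pochhammer (1 - u - of_nat m) k * ((-1) ^ k * pochhammer u (m - k))"
        using pochhammer_split_reflect[OF k, of u] by (simp only: mult_ac)
      moreover from this have "pochhammer (1 - u - of_nat m) k \<noteq> 0" using um by auto
      ultimately show ?thesis by simp
    qed
    have "(-1) ^ k * pochhammer (of_real a) m =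
        ((-1) ^ k * (-1) ^ k) * (pochhammer (1 - complex_of_real a - of_nat m) k * pochhammer (of_real a) (m - k))"
      by (subst pochhammer_split_reflect[OF k]) (simp only: mult_ac)
    hence 3: "pochhammer (1 - of_real a - of_nat m) k =
        (-1) ^ k * pochhammer (complex_of_real a) m / pochhammer (of_real a) (m - k)"
      using am by (simp add: field_simps flip: power_mult_distrib)
    have "pochhammer u m * c k = pochhammer (of_real b) k * ((-1) ^ k * of_nat (m choose k)) *
        ((-1) ^ k * pochhammer (complex_of_real a) m / pochhammer (of_real a) (m - k)) /
        pochhammer (of_real (2 * b)) k * (pochhammer u m / pochhammer (1 - u - of_nat m) k)"
      unfolding c_def 1 3 by (simp add: mult_ac)
    also have "\<dots> = ((-1) ^ k * (-1) ^ k) * ((-1) ^ k * of_nat (m choose k) * pochhammer (complex_of_real a) m /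
        (pochhammer (of_real (2 * b)) k * pochhammer (of_real a) (m - k))) *
        pochhammer (of_real b) k * pochhammer u (m - k)"
      unfolding 2 by (simp only: times_divide_eq_left times_divide_eq_right
          divide_divide_eq_left mult_ac)
    also have "\<dots> = of_real (jacobi_coeff m a (2 * b) k) *
        pochhammer (of_real b) k * pochhammer u (m - k)"
    proof -
      have "of_real (jacobi_coeff m a (2 * b) k) = (-1) ^ k * of_nat (m choose k) *
          pochhammer (complex_of_real a) m / (pochhammer (of_real (2 * b)) k * pochhammer (of_real a) (m - k))"
        unfolding jacobi_coeff_def pochhammer_of_real
        by (simp only: of_real_mult of_real_divide of_real_power of_real_minus of_real_1
              of_real_of_nat_eq)
      moreover have "(-1) ^ k * (-1) ^ k = (1 :: complex)" by (simp flip: power_mult_distrib)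
      ultimately show ?thesis by (simp only: mult_1)
    qed
    finally show "pochhammer u m * c k = of_real (jacobi_coeff m a (2 * b) k) *
        pochhammer (of_real b) k * pochhammer u (m - k)" .
  qed
  moreover have "Gamma ((of_nat n + s) / 2) / Gamma u = pochhammer u m"
    using pochhammer_Gamma[of u m] assms(2) by (simp add: ns u_def e_def)
  moreover have "u = (s + (if even n then 0 else 1)) / 2"
    by (auto simp: u_def e_def odd_iff_mod_2_eq_one)
  ultimately show ?thesis
    unfolding p_quot_def Let_def hyp by metis
qed

text \<open>The exceptional points are isolated, so the quotient agrees with the polynomial on a
  punctured neighbourhood of every s, and the limit taken by \<open>remove_sings\<close> is the
  value of the polynomial.\<close>

lemma p_fun_eq:
  assumes "\<beta> < 1"
  shows "p_fun n \<beta> s = poly (p_poly n \<beta>) s"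
proof -
  define h where "h = (\<lambda>w :: complex. (w + of_nat (n mod 2)) / 2)"
  \<comment> \<open>Omitting \<open>h s\<close> keeps the set closed and lets s itself be
    exceptional; w other than s has \<open>h w\<close> different from \<open>h s\<close>.\<close>
  have "closed (\<int>\<^sub>\<le>\<^sub>0 - {h s})"
    by (intro closed_subset_Ints) auto
  hence "open (- (\<int>\<^sub>\<le>\<^sub>0 - {h s}))" by (simp only: open_Compl)
  moreover have "h \<midarrow>s\<rightarrow> h s" unfolding h_def by (intro tendsto_intros) auto
  ultimately have "eventually (\<lambda>w. h w \<in> - (\<int>\<^sub>\<le>\<^sub>0 - {h s})) (at s)"
    by (intro topological_tendstoD[where l = "h s"]) auto
  moreover have "eventually (\<lambda>w. w \<noteq> s) (at s)" by (rule eventually_neq_at_within)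
  ultimately have "eventually (\<lambda>w. p_quot n \<beta> w = poly (p_poly n \<beta>) w) (at s)"
    by eventually_elim (intro p_quot_eq[OF assms], auto simp: h_def)
  moreover have "poly (p_poly n \<beta>) \<midarrow>s\<rightarrow> poly (p_poly n \<beta>) s"
    by (intro isContD poly_isCont)
  ultimately have "p_quot n \<beta> \<midarrow>s\<rightarrow> poly (p_poly n \<beta>) s"
    by (simp add: tendsto_cong)
  thus ?thesis unfolding p_fun_def by (rule remove_sings_eqI)
qed

theorem theorem6:
  fixes \<beta> :: real and n :: nat
  assumes "\<beta> < 1"
  shows "\<exists>P :: complex poly.
           (\<forall>s. p_fun n \<beta> s = poly P s) \<and>
           degree P = n div 2 \<and>
           perfect_reflection ((-1) ^ (n div 2)) (p_fun n \<beta>) \<and>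
           (\<forall>s. p_fun n \<beta> s = (-1) ^ (n div 2) * p_fun n \<beta> (1 - s)) \<and>
           (\<forall>s. p_fun n \<beta> s = 0 \<longrightarrow> Re s = 1 / 2) \<and>
           (\<forall>s. p_fun n \<beta> s = 0 \<and> s \<noteq> 1 / 2 \<longrightarrow>
                  cnj s \<noteq> s \<and> p_fun n \<beta> (cnj s) = 0 \<and> order (cnj s) P = order s P)"
proof -
  define P where "P = p_poly n \<beta>"
  have eq: "p_fun n \<beta> = poly P" using p_fun_eq[OF assms] by (auto simp: P_def)
  have deg: "degree P = n div 2" by (simp add: P_def degree_p_poly)
  have cnj_P: "map_poly cnj P = P" by (simp add: P_def map_poly_cnj_p_poly)
  have cnj: "poly P (cnj s) = cnj (poly P s)" for s
    by (metis cnj_P poly_cnj)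
  have zeros: "poly P s = 0 \<Longrightarrow> Re s = 1 / 2" for s
    using p_poly_zeros[OF assms] by (simp add: P_def)
  have reflect: "poly P s = (-1) ^ (n div 2) * poly P (1 - s)" for s
    using zeros_on_critical_line_reflection[OF cnj_P zeros] unfolding deg .
  \<comment> \<open>The zero polynomial would vanish at 0, off the critical line.\<close>
  have "P \<noteq> 0" using zeros[of 0] by auto
  have order: "order (cnj s) P = order s P" for s
    using order_cnj_le[OF cnj_P \<open>P \<noteq> 0\<close>, of s] order_cnj_le[OF cnj_P \<open>P \<noteq> 0\<close>, of "cnj s"] by simp
  have nonreal: "cnj s \<noteq> s" if "poly P s = 0" "s \<noteq> 1 / 2" for s
    using zeros[OF that(1)] that(2) by (auto simp: complex_eq_iff)
  have sign: "(-1) ^ (n div 2) \<in> {1, -1 :: complex}"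
    by (cases "even (n div 2)") auto
  show ?thesis
    unfolding eq perfect_reflection_def
  proof (intro exI[of _ P] conjI allI impI)
    fix s assume "poly P s = 0 \<and> s \<noteq> 1 / 2"
    thus "cnj s \<noteq> s" "poly P (cnj s) = 0" by (auto simp: nonreal cnj)
  qed (rule refl deg sign cnj reflect zeros order | assumption)+
qed

end
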